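(* Let $\mathcal{V}:[0,1]\to\mathcal{D}$ be a vineyard (admitting a decomposition into finitely many vines as described in the context), and let $P=\mathcal{V}(0)$ and $Q=\mathcal{V}(1)$. Let $w$ be the standard weighting. Then the $w$-weighted vineyard distance $\mathbb{V}^{(w)}(\mathcal{V})$ satisfies $$\mathrm{MVC}(P,Q)\le\mathbb{V}^{(w)}(\mathcal{V}).$$
   Context: Let $\mathbb{R}^2_{x\le y}=\{(x,y)\in\mathbb{R}^2 : x\le y\}$ and let $\Delta=\{(x,x)\}$ be the diagonal. A persistence diagram is a finite multiset of points of $\mathbb{R}^2_{x\le y}$ (points on $\Delta$ are allowed); $\mathcal{D}$ is the set of all persistence diagrams. A partial bijection from a multiset $P$ to a multiset $Q$ is a bijection $\pi:A\to B$ between sub-multisets $A\subseteq P$, $B\subseteq Q$. Write $d_\infty$ for the sup-norm metric on $\mathbb{R}^2$. $\mathcal{D}$ carries the topology arising from the bottleneck distance $$W_\infty(P,Q)=\min_{\pi:A\to B}\max\Big(\max_{\alpha\in A}d_\infty(\alpha,\pi(\alpha)),\max_{\alpha\in P\setminus A}d_\infty(\alpha,\Delta),\max_{\beta\in Q\setminus B}d_\infty(\beta,\Delta)\Big),$$ over partial bijections from $P$ to $Q$. A vineyard is a continuous map $\mathcal{V}:[0,1]\to\mathcal{D}$. Standing assumption: every vineyard can be decomposed into finitely many rectifiable (continuous) curves $V_i:[0,1]\to\mathbb{R}^2$, $1\le i\le m$, called vines, such that for every $t$, $\mathcal{V}(t)$ is the multiset $\{V_i(t):1\le i\le m\}$,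 and each vine $V$ in the decomposition is of one of four types: (1) $V$ never meets $\Delta$; (2) $\mathrm{Im}(V)\cap\Delta=\{x\}$ and $V^{-1}(x)$ is a closed interval containing $1$; (3) $\mathrm{Im}(V)\cap\Delta=\{x\}$ and $V^{-1}(x)$ is a closed interval containing $0$; (4) $\mathrm{Im}(V)\cap\Delta=\{x,y\}$ and $V^{-1}(x)\cup V^{-1}(y)$ is a union of two closed intervals which contains $0$ and $1$. The standard weighting is the function $w:\mathbb{R}^2_{x\le y}\to\mathbb{R}_{\ge0}$ giving the Euclidean distance to the diagonal, $w(x,y)=\frac{1}{\sqrt2}(y-x)$. The $w$-weighted vineyard distance is $\mathbb{V}^{(w)}(\mathcal{V})=\sum_{i=1}^m\int_{V_i}w\,ds$ for any decomposition into vines. All line integrals are computed with arc length $ds$ in the $\ell^\infty$ metric on the plane. For $p,q\in\mathbb{R}^2_{x\le y}$, the $w$-path distance is $d^{(w)}_{\text{path}}(p,q)=\min_{\gamma\in\Gamma(p,q)}\int_\gamma w\,ds$, where $\Gamma(p,q)$ is the set of rectifiable curves in $\mathbb{R}^2_{x\le y}$ from $p$ to $q$. For $\alpha\in\mathbb{R}^2_{x\le y}$, $d^{(w)}_{\text{path}}(\alpha,\Delta)$ denotes the $w$-path distance from $\alpha$ to the point of $\Delta$ closest to $\alpha$ in $d_\infty$ (equivalently, the minimum of $\int_\gamma w\,ds$ over rectifiable curves from $\alpha$ to any point of $\Delta$). The minimum vine cost is $$\mathrm{MVC}(P,Q)=\min_{\pi:A\to B}\Big(\sum_{\alpha\in A}d^{(w)}_{\text{path}}(\alpha,\pi(\alpha))+\sum_{\alpha\in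 P\setminus A}d^{(w)}_{\text{path}}(\alpha,\Delta)+\sum_{\beta\in Q\setminus B}d^{(w)}_{\text{path}}(\beta,\Delta)\Big),$$ where $\pi$ ranges over all partial bijections from $P$ to $Q$ and $w$ is the standard weighting. *)

theory Defs
  imports "HOL-Analysis.Analysis" "HOL-Library.Multiset"
begin

type_synonym point = "real \<times> real"

definition half_plane :: "point set" where
  "half_plane = {(x, y). x \<le> y}"

definition diagonal :: "point set" where
  "diagonal = {(x, y). x = y}"

definition d_inf :: "point \<Rightarrow> point \<Rightarrow> real" where
  "d_inf p q = infnorm (p - q)"

definition d_inf_diag :: "point \<Rightarrow> real" where
  "d_inf_diag p = (INF q\<in>diagonal. d_inf p q)"

definition nearest_diag :: "point \<Rightarrow> point" where
  "nearest_diag p = arg_min_on (d_inf p) diagonal"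


text \<open>
  A partial bijection from \<open>P\<close> to \<open>Q\<close> is encoded by its graph, a multiset \<open>M\<close> of pairs:
  the matched sub-multisets are \<open>A = image_mset fst M\<close> and \<open>B = image_mset snd M\<close>.
\<close>

definition diagrams :: "point multiset set" where
  "diagrams = {P. set_mset P \<subseteq> half_plane}"

definition partial_bijections :: "point multiset \<Rightarrow> point multiset \<Rightarrow> (point \<times> point) multiset set" where
  "partial_bijections P Q = {M. image_mset fst M \<subseteq># P \<and> image_mset snd M \<subseteq># Q}"

lemma finite_partial_bijections: "finite (partial_bijections P Q)"
proof (rule finite_subset)
  let ?L = "{xs. set xs \<subseteq> set_mset P \<times> set_mset Q \<and> length xs \<le> size P}"
  show "partial_bijections P Q \<subseteq> mset ` ?L"
  proof
    fix M assume M: "M \<in> partial_bijections P Q"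
    obtain xs where xs: "M = mset xs"
      by (metis ex_mset)
    have "set_mset (image_mset fst M) \<subseteq> set_mset P" "set_mset (image_mset snd M) \<subseteq> set_mset Q"
      using M set_mset_mono unfolding partial_bijections_def by blast+
    moreover have "size (image_mset fst M) \<le> size P"
      using M size_mset_mono unfolding partial_bijections_def by blast
    ultimately have "xs \<in> ?L"
      using xs by fastforce
    then show "M \<in> mset ` ?L"
      using xs by blast
  qed
  show "finite (mset ` ?L)"
    by (intro finite_imageI finite_lists_length_le) auto
qed

lemma partial_bijections_nonempty: "partial_bijections P Q \<noteq> {}"
proof -
  have "{#} \<in> partial_bijections P Q"
    by (simp add: partial_bijections_def)
  then show ?thesis by blast
qed

text \<open>The inserted \<open>0\<close> makes the maximum over an empty index set equal to \<open>0\<close>.\<close>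

definition bottleneck_cost :: "point multiset \<Rightarrow> point multiset \<Rightarrow> (point \<times> point) multiset \<Rightarrow> real" where
  "bottleneck_cost P Q M = Max (insert 0
     ((\<lambda>(\<alpha>, \<beta>). d_inf \<alpha> \<beta>) ` set_mset M
      \<union> d_inf_diag ` set_mset (P - image_mset fst M)
      \<union> d_inf_diag ` set_mset (Q - image_mset snd M)))"

definition bottleneck_distance :: "point multiset \<Rightarrow> point multiset \<Rightarrow> real" where
  "bottleneck_distance P Q = Min (bottleneck_cost P Q ` partial_bijections P Q)"

text \<open>
  As points on the diagonal are allowed, the bottleneck distance is only a pseudometric on diagrams;
  the topology is the one generated by its open balls.
\<close>

definition bottleneck_topology :: "point multiset topology" where
  "bottleneck_topology = topology_generated_by
     {{Q \<in> diagrams. bottleneck_distance P Q < \<epsilon>} | P \<epsilon>. P \<in> diagrams \<and> \<epsilon> > 0}"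

definition vineyard :: "(real \<Rightarrow> point multiset) \<Rightarrow> bool" where
  "vineyard \<V> \<longleftrightarrow> continuous_map (top_of_set {0..1}) bottleneck_topology \<V>"


text \<open>
  Length in the sup norm of the polygon inscribed in \<open>\<gamma>\<close> along a division of an interval into
  finitely many closed subintervals.
\<close>

definition inscribed_length :: "(real \<Rightarrow> point) \<Rightarrow> real set set \<Rightarrow> real" where
  "inscribed_length \<gamma> D = (\<Sum>K\<in>D. d_inf (\<gamma> (Inf K)) (\<gamma> (Sup K)))"

definition rectifiable_curve :: "(real \<Rightarrow> point) \<Rightarrow> bool" where
  "rectifiable_curve \<gamma> \<longleftrightarrow> path \<gamma> \<and> bdd_above (inscribed_length \<gamma> ` {D. D division_of {0..1}})"

definition arc_length :: "(real \<Rightarrow> point) \<Rightarrow> real \<Rightarrow> real" where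
  "arc_length \<gamma> t = (SUP D\<in>{D. D division_of {0..t}}. inscribed_length \<gamma> D)"

text \<open>
  For a rectifiable curve the arc length function is continuous and nondecreasing on the unit
  interval. Extended by constants to the whole line it is the distribution function of the measure
  \<open>ds\<close>, and the line integral is a Lebesgue-Stieltjes integral.
\<close>

definition line_integral :: "(point \<Rightarrow> real) \<Rightarrow> (real \<Rightarrow> point) \<Rightarrow> real" where
  "line_integral w \<gamma> =
     (LINT t:{0..1}|interval_measure (\<lambda>t. arc_length \<gamma> (max 0 (min 1 t))). w (\<gamma> t))"

definition std_weight :: "point \<Rightarrow> real" where
  "std_weight p = (snd p - fst p) / sqrt 2"


definition curves_between :: "point \<Rightarrow> point \<Rightarrow> (real \<Rightarrow> point) set" where
  "curves_between p q =
     {\<gamma>. rectifiable_curve \<gamma> \<and> path_image \<gamma> \<subseteq> half_plane \<and> pathstart \<gamma> = p \<and> pathfinish \<gamma> = q}"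

definition path_distance :: "(point \<Rightarrow> real) \<Rightarrow> point \<Rightarrow> point \<Rightarrow> real" where
  "path_distance w p q = (INF \<gamma>\<in>curves_between p q. line_integral w \<gamma>)"

definition path_distance_diag :: "(point \<Rightarrow> real) \<Rightarrow> point \<Rightarrow> real" where
  "path_distance_diag w p = path_distance w p (nearest_diag p)"

definition matching_cost ::
  "(point \<Rightarrow> real) \<Rightarrow> point multiset \<Rightarrow> point multiset \<Rightarrow> (point \<times> point) multiset \<Rightarrow> real" where
  "matching_cost w P Q M =
     (\<Sum>(\<alpha>, \<beta>)\<in>#M. path_distance w \<alpha> \<beta>)
     + (\<Sum>\<alpha>\<in>#P - image_mset fst M. path_distance_diag w \<alpha>)
     + (\<Sum>\<beta>\<in>#Q - image_mset snd M. path_distance_diag w \<beta>)"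

definition MVC :: "point multiset \<Rightarrow> point multiset \<Rightarrow> real" where
  "MVC P Q = Min (matching_cost std_weight P Q ` partial_bijections P Q)"


definition preimage01 :: "(real \<Rightarrow> point) \<Rightarrow> point \<Rightarrow> real set" where
  "preimage01 V x = {t \<in> {0..1}. V t = x}"

definition vine_type1 :: "(real \<Rightarrow> point) \<Rightarrow> bool" where
  "vine_type1 V \<longleftrightarrow> path_image V \<inter> diagonal = {}"

definition vine_type2 :: "(real \<Rightarrow> point) \<Rightarrow> bool" where
  "vine_type2 V \<longleftrightarrow>
     (\<exists>x a b. path_image V \<inter> diagonal = {x} \<and> preimage01 V x = {a..b} \<and> 1 \<in> {a..b})"

definition vine_type3 :: "(real \<Rightarrow> point) \<Rightarrow> bool" where
  "vine_type3 V \<longleftrightarrow>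
     (\<exists>x a b. path_image V \<inter> diagonal = {x} \<and> preimage01 V x = {a..b} \<and> 0 \<in> {a..b})"

text \<open>The two diagonal points of a type 4 vine are allowed to coincide.\<close>

definition vine_type4 :: "(real \<Rightarrow> point) \<Rightarrow> bool" where
  "vine_type4 V \<longleftrightarrow>
     (\<exists>x y a b c d. path_image V \<inter> diagonal = {x, y} \<and> a \<le> b \<and> c \<le> d \<and>
        preimage01 V x \<union> preimage01 V y = {a..b} \<union> {c..d} \<and> {0, 1} \<subseteq> {a..b} \<union> {c..d})"

definition vine :: "(real \<Rightarrow> point) \<Rightarrow> bool" where
  "vine V \<longleftrightarrow>
     rectifiable_curve V \<and> (vine_type1 V \<or> vine_type2 V \<or> vine_type3 V \<or> vine_type4 V)"

definition vine_decomposition ::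
  "(real \<Rightarrow> point multiset) \<Rightarrow> nat \<Rightarrow> (nat \<Rightarrow> real \<Rightarrow> point) \<Rightarrow> bool" where
  "vine_decomposition \<V> m V \<longleftrightarrow>
     (\<forall>i\<in>{1..m}. vine (V i)) \<and>
     (\<forall>t\<in>{0..1}. \<V> t = image_mset (\<lambda>i. V i t) (mset_set {1..m}))"

definition vineyard_distance :: "(point \<Rightarrow> real) \<Rightarrow> nat \<Rightarrow> (nat \<Rightarrow> real \<Rightarrow> point) \<Rightarrow> real" where
  "vineyard_distance w m V = (\<Sum>i=1..m. line_integral w (V i))"


lemma infnorm_point: "infnorm (p :: point) = max \<bar>fst p\<bar> \<bar>snd p\<bar>"
proof -
  have "(\<lambda>b. \<bar>p \<bullet> b\<bar>) ` (Basis :: point set) = {\<bar>fst p\<bar>, \<bar>snd p\<bar>}"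
    by (cases p) (auto simp: Basis_prod_def)
  then show ?thesis
    by (simp add: infnorm_Max)
qed

lemma nearest_diag_eq: "nearest_diag (x, y) = ((x + y) / 2, (x + y) / 2)"
proof -
  let ?m = "((x + y) / 2, (x + y) / 2)"
  have less: "d_inf (x, y) ?m < d_inf (x, y) q" if q: "q \<in> diagonal" "q \<noteq> ?m" for q
  proof -
    obtain z where z: "q = (z, z)"
      using q(1) by (auto simp: diagonal_def)
    with q(2) have "z \<noteq> (x + y) / 2"
      by simp
    moreover have "x - (x + y) / 2 = (x - y) / 2" "y - (x + y) / 2 = (y - x) / 2"
      by (simp_all add: field_simps)
    ultimately show ?thesis
      unfolding d_inf_def infnorm_point z by (simp add: max_def abs_if) argo
  qed
  have "?m \<in> diagonal"
    by (simp add: diagonal_def)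
  then have "is_arg_min (d_inf (x, y)) (\<lambda>q. q \<in> diagonal) q \<longleftrightarrow> q = ?m" for q
    unfolding is_arg_min_def using less by (metis less_asym)
  then show ?thesis
    by (simp add: nearest_diag_def arg_min_on_def arg_min_def)
qed

lemma bottleneck_distance_self: "bottleneck_distance P P = 0"
proof -
  let ?M = "image_mset (\<lambda>p. (p, p)) P"
  have M: "?M \<in> partial_bijections P P"
    by (simp add: partial_bijections_def multiset.map_comp comp_def)
  have cost: "bottleneck_cost P P ?M = 0"
  proof -
    have "(\<lambda>(\<alpha>, \<beta>). d_inf \<alpha> \<beta>) ` set_mset ?M \<subseteq> {0}"
      by (auto simp: d_inf_def infnorm_point)
    then have "insert (0 :: real) ((\<lambda>(\<alpha>, \<beta>). d_inf \<alpha> \<beta>) ` set_mset ?M) = {0}"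
      by blast
    moreover have "image_mset fst ?M = P" "image_mset snd ?M = P"
      by (simp_all add: multiset.map_comp comp_def)
    ultimately show ?thesis
      by (simp only: bottleneck_cost_def diff_cancel set_mset_empty image_empty Un_empty_right Max_singleton)
  qed
  have "0 \<le> bottleneck_cost P P N" for N
    unfolding bottleneck_cost_def by (intro Max_ge) auto
  then show ?thesis
    unfolding bottleneck_distance_def
    using M cost finite_partial_bijections
    by (intro Min_eqI) (auto intro!: image_eqI[where x = ?M])
qed

lemma topspace_bottleneck_topology: "topspace bottleneck_topology = diagrams"
proof -
  have "\<Union>{{Q \<in> diagrams. bottleneck_distance P Q < \<epsilon>} | P \<epsilon>. P \<in> diagrams \<and> \<epsilon> > 0} = diagrams"
    (is "\<Union>?B = _")
  proof
    show "\<Union>?B \<subseteq> diagrams"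
      by blast
    show "diagrams \<subseteq> \<Union>?B"
    proof
      fix P assume P: "P \<in> diagrams"
      then have "P \<in> {Q \<in> diagrams. bottleneck_distance P Q < 1}"
        by (simp add: bottleneck_distance_self)
      moreover have "{Q \<in> diagrams. bottleneck_distance P Q < 1} \<in> ?B"
        using P zero_less_one by blast
      ultimately show "P \<in> \<Union>?B"
        by (rule UnionI[rotated])
    qed
  qed
  then show ?thesis
    unfolding bottleneck_topology_def topology_generated_by_topspace .
qed

end

(* Points of the diagonal may be matched like any others, so the vines themselves give a perfect
   matching of the initial diagram with the final one: every vine is a curve in the half plane
   joining the two points that it matches, hence competes in their path distance. *)
theory Submission
  imports Defs
begin

text \<open>A nonintegrable integrand also obeys the bound: its Bochner integral is 0 by
  convention.\<close>

lemma line_integral_nonneg: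
  assumes "\<And>p. p \<in> path_image \<gamma> \<Longrightarrow> 0 \<le> w p"
  shows "0 \<le> line_integral w \<gamma>"
  unfolding line_integral_def set_lebesgue_integral_def
  by (intro Bochner_Integration.integral_nonneg)
    (auto simp: indicator_def path_image_def intro!: assms)

text \<open>A real \<open>INF\<close> is known to be a lower bound only for a set bounded below;
  nonnegativity of \<open>w\<close> supplies the bound 0.\<close>

lemma path_distance_le_line_integral:
  assumes "\<And>p. p \<in> half_plane \<Longrightarrow> 0 \<le> w p" and "\<gamma> \<in> curves_between p q"
  shows "path_distance w p q \<le> line_integral w \<gamma>"
  unfolding path_distance_def
proof (rule cINF_lower)
  show "bdd_below (line_integral w ` curves_between p q)"
    by (rule bdd_belowI2[where m = 0], rule line_integral_nonneg)
      (use assms(1) in \<open>auto simp: curves_between_def\<close>)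
qed fact

lemma std_weight_nonneg: "p \<in> half_plane \<Longrightarrow> 0 \<le> std_weight p"
  by (auto simp: half_plane_def std_weight_def)

text \<open>A continuous map lands in the topspace. This confines the vines to the half plane, since
  \<open>vine\<close> alone does not fix a side of the diagonal.\<close>

lemma vineyard_in_diagrams:
  assumes "vineyard \<V>" and "t \<in> {0..1}"
  shows "\<V> t \<in> diagrams"
  using assms continuous_map_image_subset_topspace
  unfolding vineyard_def topspace_bottleneck_topology[symmetric] by fastforce

lemma vine_in_curves_between:
  assumes "vineyard \<V>" and "vine_decomposition \<V> m V" and "i \<in> {1..m}"
  shows "V i \<in> curves_between (V i 0) (V i 1)"
proof -
  have "V i t \<in> half_plane" if "t \<in> {0..1}" for t
    using vineyard_in_diagrams[OF assms(1) that] assms(2,3) that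
    by (auto simp: vine_decomposition_def diagrams_def)
  moreover have "rectifiable_curve (V i)"
    using assms(2,3) by (auto simp: vine_decomposition_def vine_def)
  ultimately show ?thesis
    by (auto simp: curves_between_def path_image_def pathstart_def pathfinish_def)
qed

theorem theorem8:
  fixes \<V> :: "real \<Rightarrow> point multiset"
    and m :: nat
    and V :: "nat \<Rightarrow> real \<Rightarrow> point"
  assumes "vineyard \<V>"
    and "vine_decomposition \<V> m V"
  shows "MVC (\<V> 0) (\<V> 1) \<le> vineyard_distance std_weight m V"
proof -
  \<comment> \<open>Indexing by vines keeps multiplicities: vines sharing both endpoints give
    repeated pairs.\<close>
  define M where "M = image_mset (\<lambda>i. (V i 0, V i 1)) (mset_set {1..m})"
  have fst: "image_mset fst M = \<V> 0" and snd: "image_mset snd M = \<V> 1"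
    using assms(2) by (simp_all add: M_def vine_decomposition_def multiset.map_comp comp_def)
  have "MVC (\<V> 0) (\<V> 1) \<le> matching_cost std_weight (\<V> 0) (\<V> 1) M"
    unfolding MVC_def
    by (intro Min_le finite_imageI finite_partial_bijections imageI)
      (simp add: partial_bijections_def fst snd)
  also have "\<dots> = (\<Sum>i = 1..m. path_distance std_weight (V i 0) (V i 1))"
    \<comment> \<open>Both unmatched remainders become differences of equal multisets, so the
      diagonal terms vanish.\<close>
    unfolding matching_cost_def fst snd
    by (simp add: M_def multiset.map_comp comp_def sum_unfold_sum_mset)
  also have "\<dots> \<le> vineyard_distance std_weight m V"
    unfolding vineyard_distance_def
    by (intro sum_mono path_distance_le_line_integral std_weight_nonneg
        vine_in_curves_between[OF assms])
  finally show ?thesis .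
qed

end
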